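(* Let $G$ and $H$ be two finite groups, let $(\psi\times\gamma,\beta)$ be an autoisoclinism between them, and let $g\in S(G,\mathrm{Aut}(G))$. Then $$\mathrm{Pr}_g(G,\mathrm{Aut}(G)) = \mathrm{Pr}_{\beta(g)}(H,\mathrm{Aut}(H)).$$
   Context: For a group $G$ with automorphism group $\mathrm{Aut}(G)$, $x\in G$ and $\alpha\in\mathrm{Aut}(G)$, write $[x,\alpha] := x^{-1}\alpha(x)$. Let $S(G,\mathrm{Aut}(G)) := \{[x,\alpha] : x\in G,\ \alpha\in\mathrm{Aut}(G)\}$, $K(G) := \langle S(G,\mathrm{Aut}(G))\rangle$ and $L(G) := \{x\in G : [x,\alpha]=1 \text{ for all } \alpha\in\mathrm{Aut}(G)\}$; $K(G)$ and $L(G)$ are characteristic subgroups of $G$. For finite $G$ and $g\in G$, $$\mathrm{Pr}_g(G,\mathrm{Aut}(G)) := \frac{|\{(x,\alpha)\in G\times \mathrm{Aut}(G) : [x,\alpha]=g\}|}{|G||\mathrm{Aut}(G)|}.$$ The map $a_{(G,\mathrm{Aut}(G))} : \frac{G}{L(G)}\times\mathrm{Aut}(G)\to K(G)$ is $(xL(G),\alpha)\mapsto[x,\alpha]$ (it is well defined), and similarly for $H$. An autoisoclinism between groups $G$ and $H$ is a pair $(\psi\times\gamma,\beta)$, where $\psi : \frac{G}{L(G)}\to\frac{H}{L(H)}$, $\beta : K(G)\to K(H)$ and $\gamma : \mathrm{Aut}(G)\to\mathrm{Aut}(H)$ are group isomorphisms such that $$\beta\circ a_{(G,\mathrm{Aut}(G))}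 = a_{(H,\mathrm{Aut}(H))}\circ(\psi\times\gamma).$$ *)

theory Defs
  imports "HOL-Algebra.Algebra"
begin

text \<open>Automorphisms are the elements of \<^const>\<open>auto\<close>: they are extensional (undefined outside the
  carrier), so each automorphism is counted exactly once, and they form the group
  \<^const>\<open>AutoGroup\<close> under composition.\<close>

definition autocommutator :: "('a, 'c) monoid_scheme \<Rightarrow> 'a \<Rightarrow> ('a \<Rightarrow> 'a) \<Rightarrow> 'a" where
  "autocommutator G x \<alpha> = inv\<^bsub>G\<^esub> x \<otimes>\<^bsub>G\<^esub> \<alpha> x"

definition autocommutators :: "('a, 'c) monoid_scheme \<Rightarrow> 'a set" where
  "autocommutators G = {autocommutator G x \<alpha> | x \<alpha>. x \<in> carrier G \<and> \<alpha> \<in> carrier (AutoGroup G)}"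

definition autocommutator_subgroup :: "('a, 'c) monoid_scheme \<Rightarrow> 'a set" where
  "autocommutator_subgroup G = generate G (autocommutators G)"

definition absolute_center :: "('a, 'c) monoid_scheme \<Rightarrow> 'a set" where
  "absolute_center G =
     {x \<in> carrier G. \<forall>\<alpha> \<in> carrier (AutoGroup G). autocommutator G x \<alpha> = \<one>\<^bsub>G\<^esub>}"

definition Pr_auto :: "('a, 'c) monoid_scheme \<Rightarrow> 'a \<Rightarrow> real" where
  "Pr_auto G g =
     real (card {(x, \<alpha>). x \<in> carrier G \<and> \<alpha> \<in> carrier (AutoGroup G) \<and> autocommutator G x \<alpha> = g})
       / (real (card (carrier G)) * real (card (carrier (AutoGroup G))))"

text \<open>The map \<open>(xL(G), \<alpha>) \<mapsto> [x, \<alpha>]\<close>; existence and uniqueness of the described value is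
  \<open>autocommutator_map_coset\<close> below. The elements of the quotient \<open>G Mod absolute_center G\<close> are
  by definition right cosets, which are also the left ones, since the absolute center is normal.\<close>

definition autocommutator_map ::
    "('a, 'c) monoid_scheme \<Rightarrow> 'a set \<times> ('a \<Rightarrow> 'a) \<Rightarrow> 'a" where
  "autocommutator_map G = (\<lambda>(C, \<alpha>).
     THE k. \<exists>x \<in> carrier G. C = x <#\<^bsub>G\<^esub> absolute_center G \<and> k = autocommutator G x \<alpha>)"

definition autoisoclinism ::
    "('a, 'c) monoid_scheme \<Rightarrow> ('b, 'd) monoid_scheme \<Rightarrow> ('a set \<Rightarrow> 'b set) \<Rightarrow>
      (('a \<Rightarrow> 'a) \<Rightarrow> ('b \<Rightarrow> 'b)) \<Rightarrow> ('a \<Rightarrow> 'b) \<Rightarrow> bool" where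
  "autoisoclinism G H \<psi> \<gamma> \<beta> \<longleftrightarrow>
     \<psi> \<in> iso (G Mod absolute_center G) (H Mod absolute_center H) \<and>
     \<gamma> \<in> iso (AutoGroup G) (AutoGroup H) \<and>
     \<beta> \<in> iso (G\<lparr>carrier := autocommutator_subgroup G\<rparr>) (H\<lparr>carrier := autocommutator_subgroup H\<rparr>) \<and>
     (\<forall>p \<in> carrier (G Mod absolute_center G) \<times> carrier (AutoGroup G).
        \<beta> (autocommutator_map G p) = autocommutator_map H (map_prod \<psi> \<gamma> p))"

lemma carrier_AutoGroup: "carrier (AutoGroup G) = auto G"
  by (simp add: AutoGroup_def)

context group
begin

lemma autoD:
  assumes "\<alpha> \<in> auto G"
  shows "\<And>x. x \<in> carrier G \<Longrightarrow> \<alpha> x \<in> carrier G"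
    and "\<And>x y. x \<in> carrier G \<Longrightarrow> y \<in> carrier G \<Longrightarrow> \<alpha> (x \<otimes> y) = \<alpha> x \<otimes> \<alpha> y"
  using assms by (auto simp: auto_def hom_def)

lemma absolute_center_iff:
  "x \<in> absolute_center G \<longleftrightarrow> x \<in> carrier G \<and> (\<forall>\<alpha> \<in> auto G. \<alpha> x = x)"
proof -
  have "(inv x \<otimes> \<alpha> x = \<one>) \<longleftrightarrow> \<alpha> x = x" if "x \<in> carrier G" "\<alpha> \<in> auto G" for \<alpha>
    using autoD(1)[OF that(2) that(1)] that(1) by (metis inv_closed inv_equality inv_inv l_inv)
  then show ?thesis
    by (auto simp: absolute_center_def autocommutator_def carrier_AutoGroup)
qed

lemma conj_in_auto:
  assumes a: "a \<in> carrier G"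
  shows "(\<lambda>x \<in> carrier G. a \<otimes> x \<otimes> inv a) \<in> auto G"
proof -
  have inv_cancel: "inv a \<otimes> (a \<otimes> y) = y" "a \<otimes> (inv a \<otimes> y) = y" if "y \<in> carrier G" for y
    using a that by (simp_all add: m_assoc[symmetric])
  have "bij_betw (\<lambda>x. a \<otimes> x \<otimes> inv a) (carrier G) (carrier G)"
    by (rule bij_betw_byWitness[where f' = "\<lambda>x. inv a \<otimes> x \<otimes> a"])
       (use a in \<open>simp_all add: image_subset_iff m_assoc inv_cancel\<close>)
  moreover have "a \<otimes> (x \<otimes> y) \<otimes> inv a = (a \<otimes> x \<otimes> inv a) \<otimes> (a \<otimes> y \<otimes> inv a)"
    if "x \<in> carrier G" "y \<in> carrier G" for x y
    using a that by (simp add: m_assoc inv_cancel)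
  ultimately show ?thesis
    using a by (auto simp: auto_def Bij_def hom_def cong: bij_betw_cong)
qed

lemma absolute_center_central:
  assumes "z \<in> absolute_center G" "a \<in> carrier G"
  shows "a \<otimes> z = z \<otimes> a"
proof -
  have z: "z \<in> carrier G" using assms(1) by (simp add: absolute_center_iff)
  have "(\<lambda>x \<in> carrier G. a \<otimes> x \<otimes> inv a) z = z"
    using assms conj_in_auto absolute_center_iff by blast
  then show ?thesis
    using z assms(2) by (simp add: inv_solve_right')
qed

lemma absolute_center_subgroup: "subgroup (absolute_center G) G"
proof (rule subgroupI)
  show "absolute_center G \<subseteq> carrier G" by (auto simp: absolute_center_iff)
  have "\<alpha> \<one> = \<one>" if "\<alpha> \<in> auto G" for \<alpha>
    using that autoD[OF that] by (metis l_one one_closed r_cancel_one')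
  then have "\<one> \<in> absolute_center G" by (simp add: absolute_center_iff)
  then show "absolute_center G \<noteq> {}" by blast
next
  fix x assume x: "x \<in> absolute_center G"
  have "\<alpha> (inv x) = inv x" if "\<alpha> \<in> auto G" for \<alpha>
  proof -
    interpret group_hom G G \<alpha>
      using that is_group by (simp add: group_hom_def group_hom_axioms_def auto_def)
    have "x \<in> carrier G" "\<alpha> x = x" using x that by (simp_all add: absolute_center_iff)
    then show ?thesis by (metis hom_inv)
  qed
  then show "inv x \<in> absolute_center G" using x by (simp add: absolute_center_iff)
next
  fix x y assume "x \<in> absolute_center G" "y \<in> absolute_center G"
  then show "x \<otimes> y \<in> absolute_center G" by (fastforce simp: absolute_center_iff autoD)
qed

lemma absolute_center_l_coset:
  assumes "x \<in> carrier G"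
  shows "x <#\<^bsub>G\<^esub> absolute_center G = absolute_center G #> x"
  unfolding l_coset_def r_coset_def
  by (rule SUP_cong) (simp_all add: absolute_center_central[OF _ assms])

lemma absolute_center_normal: "absolute_center G \<lhd> G"
  by (rule normalI) (auto simp: absolute_center_subgroup absolute_center_l_coset)

lemma autocommutator_subgroup_subgroup: "subgroup (autocommutator_subgroup G) G"
  unfolding autocommutator_subgroup_def
  by (rule generate_is_subgroup)
     (auto simp: autocommutators_def autocommutator_def carrier_AutoGroup autoD)

lemma autocommutator_map_coset:
  assumes x: "x \<in> carrier G" and \<alpha>: "\<alpha> \<in> carrier (AutoGroup G)"
  shows "autocommutator_map G (x <#\<^bsub>G\<^esub> absolute_center G, \<alpha>) = autocommutator G x \<alpha>"
proof -
  have \<alpha>': "\<alpha> \<in> auto G" using \<alpha> by (simp add: carrier_AutoGroup)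
  have "autocommutator G y \<alpha> = autocommutator G x \<alpha>"
    if y: "y \<in> carrier G" and eq: "x <#\<^bsub>G\<^esub> absolute_center G = y <#\<^bsub>G\<^esub> absolute_center G" for y
  proof -
    have "y \<in> y <#\<^bsub>G\<^esub> absolute_center G"
      using y subgroup.one_closed[OF absolute_center_subgroup] r_one[OF y]
      unfolding l_coset_def by force
    then obtain z where z: "z \<in> absolute_center G" "y = x \<otimes> z"
      using eq by (auto simp: l_coset_def)
    have zc: "z \<in> carrier G" and \<alpha>z: "\<alpha> z = z"
      using z(1) \<alpha>' by (auto simp: absolute_center_iff)
    have \<alpha>x: "\<alpha> x \<in> carrier G" using autoD(1)[OF \<alpha>' x] .
    have "inv (x \<otimes> z) \<otimes> \<alpha> (x \<otimes> z) = inv z \<otimes> ((inv x \<otimes> \<alpha> x) \<otimes> z)"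
      using x zc \<alpha>x by (simp add: autoD[OF \<alpha>'] \<alpha>z inv_mult_group m_assoc)
    also have "\<dots> = inv z \<otimes> (z \<otimes> (inv x \<otimes> \<alpha> x))"
      using absolute_center_central[OF z(1), of "inv x \<otimes> \<alpha> x"] x \<alpha>x by simp
    also have "\<dots> = inv x \<otimes> \<alpha> x"
      using x zc \<alpha>x by (simp add: inv_solve_left')
    finally show ?thesis using z(2) by (simp add: autocommutator_def)
  qed
  then show ?thesis
    unfolding autocommutator_map_def prod.case using x by (intro the_equality) blast+
qed

end

end

theory Submission
  imports Defs
begin

text \<open>The commutator \<open>[x, \<alpha>]\<close> depends on \<open>x\<close> only through its coset modulo the absolute center
  \<open>L(G)\<close>, and all these cosets have size \<open>|L(G)|\<close>. Hence each pair \<open>(xL(G), \<alpha>)\<close> with value \<open>g\<close>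
  accounts for exactly \<open>|L(G)|\<close> pairs \<open>(x, \<alpha>)\<close>, and since \<open>|G| = |L(G)| |G/L(G)|\<close> the factor
  \<open>|L(G)|\<close> cancels: \<open>Pr\<^sub>g\<close> is the proportion of pairs in \<open>G/L(G) \<times> Aut(G)\<close> whose value is \<open>g\<close>
  (lemma \<open>Pr_auto_quotient\<close>). This quotient form mentions only data that an autoisoclinism
  transports: \<open>\<psi> \<times> \<gamma>\<close> is a bijection of the two sets of pairs, and because \<open>\<beta>\<close> is injective
  on \<open>K(G)\<close> it matches the pairs of value \<open>g\<close> with those of value \<open>\<beta>(g)\<close>
  (lemma \<open>autoisoclinism_fibre_bij\<close>).\<close>

definition autocommutator_fibre ::
    "('a, 'c) monoid_scheme \<Rightarrow> 'a \<Rightarrow> ('a set \<times> ('a \<Rightarrow> 'a)) set" where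
  "autocommutator_fibre G g =
     {p \<in> carrier (G Mod absolute_center G) \<times> carrier (AutoGroup G). autocommutator_map G p = g}"

context group
begin

lemma finite_auto:
  assumes "finite (carrier G)"
  shows "finite (auto G)"
proof (rule finite_subset)
  show "auto G \<subseteq> carrier G \<rightarrow>\<^sub>E carrier G"
    by (auto simp: auto_def Bij_def hom_def PiE_def)
  show "finite (carrier G \<rightarrow>\<^sub>E carrier G)"
    using assms by (simp add: finite_PiE)
qed

text \<open>The carrier of the quotient consists of right cosets, whereas the commutator map is described
  by left ones; the two agree because \<open>L(G)\<close> is central, so any element of a coset can serve as
  its representative.\<close>

lemma autocommutator_map_r_coset:
  assumes "C \<in> carrier (G Mod absolute_center G)" "\<alpha> \<in> carrier (AutoGroup G)" "x \<in> C"
  shows "x \<in> carrier G" and "C = absolute_center G #> x"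
    and "autocommutator_map G (C, \<alpha>) = autocommutator G x \<alpha>"
proof -
  have C: "C \<in> rcosets absolute_center G"
    using assms(1) by (simp add: FactGroup_def)
  show x: "x \<in> carrier G"
    using subgroup.rcosets_carrier[OF absolute_center_subgroup is_group C] assms(3)
    by blast
  obtain y where y: "y \<in> carrier G" "C = absolute_center G #> y"
    using C by (auto simp: RCOSETS_def)
  show eq: "C = absolute_center G #> x"
    using repr_independence[OF _ y(1) absolute_center_subgroup, of x] assms(3) y(2) by simp
  show "autocommutator_map G (C, \<alpha>) = autocommutator G x \<alpha>"
    using autocommutator_map_coset[OF x assms(2)] absolute_center_l_coset[OF x] eq by simp
qed

text \<open>Ensures that all values of the commutator map lie in \<open>K(G)\<close>, where an autoisoclinism gives
  control over \<open>\<beta>\<close>.\<close>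

lemma autocommutator_map_in_autocommutators:
  assumes "p \<in> carrier (G Mod absolute_center G) \<times> carrier (AutoGroup G)"
  shows "autocommutator_map G p \<in> autocommutators G"
proof -
  obtain C \<alpha> where p: "p = (C, \<alpha>)" "C \<in> carrier (G Mod absolute_center G)"
      "\<alpha> \<in> carrier (AutoGroup G)"
    using assms by blast
  obtain x where "x \<in> C"
    using p(2) rcos_self[OF _ absolute_center_subgroup] by (auto simp: FactGroup_def RCOSETS_def)
  then show ?thesis
    using autocommutator_map_r_coset[OF p(2,3)] p by (auto simp: autocommutators_def)
qed

text \<open>The pairs \<open>(x, \<alpha>)\<close> lying over a fixed \<open>(C, \<alpha>)\<close> are those with \<open>x \<in> C\<close>. So the set of pairs
  with \<open>[x, \<alpha>] = g\<close> is a disjoint union, over the fibre of \<open>g\<close>, of sets of size \<open>|L(G)|\<close>.\<close>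

lemma card_autocommutator_pairs:
  assumes fin: "finite (carrier G)"
  shows "card {(x, \<alpha>). x \<in> carrier G \<and> \<alpha> \<in> carrier (AutoGroup G) \<and> autocommutator G x \<alpha> = g}
           = card (autocommutator_fibre G g) * card (absolute_center G)" (is "card ?A = _")
proof -
  let ?L = "absolute_center G" and ?N = "autocommutator_fibre G g"
  have N_D: "C \<in> carrier (G Mod ?L)" "\<alpha> \<in> carrier (AutoGroup G)" "autocommutator_map G (C, \<alpha>) = g"
    if "(C, \<alpha>) \<in> ?N" for C \<alpha>
    using that by (auto simp: autocommutator_fibre_def)
  have rcos: "carrier (G Mod ?L) = rcosets ?L"
    by (simp add: FactGroup_def)
  have sub: "?L \<subseteq> carrier G"
    by (rule subgroup.subset[OF absolute_center_subgroup])
  have finQ: "finite (rcosets ?L)"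
    by (rule finite_subset[where B = "Pow (carrier G)"])
       (use fin subgroup.rcosets_carrier[OF absolute_center_subgroup is_group] in auto)
  have finN: "finite ?N"
    by (rule finite_subset[OF _ finite_cartesian_product[OF finQ finite_auto[OF fin]]])
       (auto simp: autocommutator_fibre_def carrier_AutoGroup rcos)
  have cosets: "finite (fst p) \<and> card (fst p) = card ?L" if "p \<in> ?N" for p
  proof -
    have C: "fst p \<in> rcosets ?L"
      using that unfolding autocommutator_fibre_def rcos by (simp add: mem_Times_iff)
    have "fst p \<subseteq> carrier G"
      by (rule subgroup.rcosets_carrier[OF absolute_center_subgroup is_group C])
    then show ?thesis
      by (intro conjI finite_subset[OF _ fin] card_rcosets_equal[OF C sub, symmetric])
  qed
  \<comment> \<open>Forgetting the coset loses nothing, since \<open>x\<close> determines it.\<close>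
  have "bij_betw (\<lambda>(p, x). (x, snd p)) (Sigma ?N fst) ?A"
  proof (rule bij_betw_byWitness[where f' = "\<lambda>(x, \<alpha>). ((?L #> x, \<alpha>), x)"])
    show "\<forall>q \<in> Sigma ?N fst. (\<lambda>(x, \<alpha>). ((?L #> x, \<alpha>), x)) ((\<lambda>(p, x). (x, snd p)) q) = q"
    proof
      fix q assume "q \<in> Sigma ?N fst"
      then obtain C \<alpha> x where q: "q = ((C, \<alpha>), x)" "(C, \<alpha>) \<in> ?N" "x \<in> C"
        by (cases q, cases "fst q") simp
      have "C = ?L #> x"
        by (rule autocommutator_map_r_coset(2)[OF N_D(1,2)[OF q(2)] q(3)])
      then show "(\<lambda>(x, \<alpha>). ((?L #> x, \<alpha>), x)) ((\<lambda>(p, x). (x, snd p)) q) = q"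
        using q(1) by simp
    qed
    show "\<forall>q \<in> ?A. (\<lambda>(p, x). (x, snd p)) ((\<lambda>(x, \<alpha>). ((?L #> x, \<alpha>), x)) q) = q"
      by (simp add: split_beta)
    show "(\<lambda>(p, x). (x, snd p)) ` Sigma ?N fst \<subseteq> ?A"
    proof
      fix r assume "r \<in> (\<lambda>(p, x). (x, snd p)) ` Sigma ?N fst"
      then obtain p x where p: "r = (x, snd p)" "p \<in> ?N" "x \<in> fst p"
        by (elim imageE SigmaE) simp
      obtain C \<alpha> where "p = (C, \<alpha>)"
        by (cases p)
      with p have r: "r = (x, \<alpha>)" "(C, \<alpha>) \<in> ?N" "x \<in> C"
        by simp_all
      then show "r \<in> ?A"
        using autocommutator_map_r_coset(1,3)[OF N_D(1,2)[OF r(2)] r(3)] N_D(2,3)[OF r(2)] by simp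
    qed
    show "(\<lambda>(x, \<alpha>). ((?L #> x, \<alpha>), x)) ` ?A \<subseteq> Sigma ?N fst"
    proof
      fix q assume "q \<in> (\<lambda>(x, \<alpha>). ((?L #> x, \<alpha>), x)) ` ?A"
      then obtain x \<alpha> where x: "x \<in> carrier G" and \<alpha>: "\<alpha> \<in> carrier (AutoGroup G)"
        and g: "autocommutator G x \<alpha> = g" and q: "q = ((?L #> x, \<alpha>), x)"
        by (elim imageE) (simp add: split_beta)
      have "autocommutator_map G (?L #> x, \<alpha>) = g"
        using autocommutator_map_coset[OF x \<alpha>] g unfolding absolute_center_l_coset[OF x] by simp
      then have "(?L #> x, \<alpha>) \<in> ?N"
        using \<alpha> rcosetsI[OF sub x] by (simp add: autocommutator_fibre_def rcos)
      then show "q \<in> Sigma ?N fst"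
        using rcos_self[OF x absolute_center_subgroup] q by simp
    qed
  qed
  then have "card ?A = card (Sigma ?N fst)"
    by (rule bij_betw_same_card[symmetric])
  also have "\<dots> = (\<Sum>p\<in>?N. card (fst p))"
    by (rule card_SigmaI[OF finN]) (simp add: cosets)
  also have "\<dots> = card ?N * card ?L"
    by (simp add: cosets)
  finally show ?thesis .
qed

text \<open>Numerator and denominator of \<open>Pr\<^sub>g\<close> both carry the factor \<open>|L(G)|\<close>, the numerator by the
  preceding count and the denominator by Lagrange's theorem.\<close>

lemma Pr_auto_quotient:
  assumes fin: "finite (carrier G)"
  shows "Pr_auto G g = real (card (autocommutator_fibre G g))
           / (real (card (carrier (G Mod absolute_center G))) * real (card (carrier (AutoGroup G))))"
proof -
  let ?L = "absolute_center G"
  have "card ?L > 0"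
    using subgroup.finite_imp_card_positive[OF absolute_center_subgroup fin] .
  moreover have "card (carrier G) = card (carrier (G Mod ?L)) * card ?L"
    using lagrange[OF absolute_center_subgroup] by (simp add: FactGroup_def order_def)
  ultimately show ?thesis
    unfolding Pr_auto_def card_autocommutator_pairs[OF fin] by simp
qed

end

text \<open>Compatibility sends a pair of value \<open>k\<close> to one of value \<open>\<beta>(k)\<close>. Injectivity of \<open>\<beta>\<close> on \<open>K(G)\<close>
  gives the converse, that only pairs of value \<open>g\<close> land on \<open>\<beta>(g)\<close>; the hypothesis on
  \<open>g\<close> puts it in \<open>K(G)\<close>, outside which \<open>\<beta>\<close> is arbitrary.\<close>

lemma autoisoclinism_fibre_bij:
  assumes "group G" and iso: "autoisoclinism G H \<psi> \<gamma> \<beta>" and g: "g \<in> autocommutators G"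
  shows "bij_betw (map_prod \<psi> \<gamma>) (autocommutator_fibre G g) (autocommutator_fibre H (\<beta> g))"
proof -
  interpret group G by fact
  let ?P = "carrier (G Mod absolute_center G) \<times> carrier (AutoGroup G)"
  let ?Q = "carrier (H Mod absolute_center H) \<times> carrier (AutoGroup H)"
  have bij: "bij_betw (map_prod \<psi> \<gamma>) ?P ?Q"
    using iso by (intro bij_betw_map_prod) (auto simp: autoisoclinism_def iso_def)
  have inj: "inj_on \<beta> (autocommutator_subgroup G)"
    using iso by (auto simp: autoisoclinism_def iso_def bij_betw_def)
  have K: "autocommutators G \<subseteq> autocommutator_subgroup G"
    unfolding autocommutator_subgroup_def by (auto intro: generate.incl)
  have value_iff: "autocommutator_map H (map_prod \<psi> \<gamma> p) = \<beta> g \<longleftrightarrow> autocommutator_map G p = g"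
    if "p \<in> ?P" for p
  proof -
    have "autocommutator_map H (map_prod \<psi> \<gamma> p) = \<beta> (autocommutator_map G p)"
      using iso that by (auto simp: autoisoclinism_def)
    then show ?thesis
      using inj_on_eq_iff[OF inj] K g autocommutator_map_in_autocommutators[OF that] by auto
  qed
  have "map_prod \<psi> \<gamma> ` autocommutator_fibre G g = autocommutator_fibre H (\<beta> g)"
  proof (intro equalityI subsetI)
    fix q assume "q \<in> map_prod \<psi> \<gamma> ` autocommutator_fibre G g"
    then obtain p where p: "p \<in> ?P" "autocommutator_map G p = g" "q = map_prod \<psi> \<gamma> p"
      unfolding autocommutator_fibre_def by (elim imageE CollectE conjE)
    then show "q \<in> autocommutator_fibre H (\<beta> g)"
      using bij_betw_apply[OF bij p(1)] value_iff[OF p(1)] unfolding autocommutator_fibre_def by simp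
  next
    fix q assume q: "q \<in> autocommutator_fibre H (\<beta> g)"
    then have "q \<in> map_prod \<psi> \<gamma> ` ?P"
      using bij_betw_imp_surj_on[OF bij] unfolding autocommutator_fibre_def by simp
    then obtain p where p: "q = map_prod \<psi> \<gamma> p" "p \<in> ?P"
      by (rule imageE)
    then have "p \<in> autocommutator_fibre G g"
      using q value_iff[OF p(2)] unfolding autocommutator_fibre_def by simp
    then show "q \<in> map_prod \<psi> \<gamma> ` autocommutator_fibre G g"
      unfolding p(1) by (rule imageI)
  qed
  moreover have "inj_on (map_prod \<psi> \<gamma>) (autocommutator_fibre G g)"
    by (rule inj_on_subset[OF bij_betw_imp_inj_on[OF bij]]) (simp add: autocommutator_fibre_def)
  ultimately show ?thesis
    by (simp add: bij_betw_def)
qed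

theorem theorem5p1:
  fixes G :: "('a, 'c) monoid_scheme" and H :: "('b, 'd) monoid_scheme"
    and \<psi> :: "'a set \<Rightarrow> 'b set" and \<gamma> :: "('a \<Rightarrow> 'a) \<Rightarrow> ('b \<Rightarrow> 'b)" and \<beta> :: "'a \<Rightarrow> 'b" and g :: 'a
  assumes "group G" and "finite (carrier G)"
    and "group H" and "finite (carrier H)"
    and "autoisoclinism G H \<psi> \<gamma> \<beta>"
    and "g \<in> autocommutators G"
  shows "Pr_auto G g = Pr_auto H (\<beta> g)"
proof -
  have "card (autocommutator_fibre G g) = card (autocommutator_fibre H (\<beta> g))"
    by (rule bij_betw_same_card[OF autoisoclinism_fibre_bij[OF assms(1,5,6)]])
  moreover have "card (carrier (G Mod absolute_center G)) = card (carrier (H Mod absolute_center H))"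
    using assms(5) by (auto simp: autoisoclinism_def iso_def intro: bij_betw_same_card)
  moreover have "card (carrier (AutoGroup G)) = card (carrier (AutoGroup H))"
    using assms(5) by (auto simp: autoisoclinism_def iso_def intro: bij_betw_same_card)
  ultimately show ?thesis
    by (simp add: group.Pr_auto_quotient assms)
qed

end
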